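(* Let $f(\cdot;i):\mathbb{R}^d\to\mathbb{R}$, $i\in[n]$, and $F(w)=\frac1n\sum_{i=1}^n f(w;i)$. Assume: (a) $\mathrm{dom}(F)\neq\emptyset$ and $F_*:=\inf_{w\in\mathbb{R}^d}F(w)>-\infty$; (b) there is $L>0$ such that for every $i\in[n]$ and all $w,w'\in\mathrm{dom}(F)$, $\|\nabla f(w;i)-\nabla f(w';i)\|\le L\|w-w'\|$; (c) there are finite constants $\Theta,\sigma\ge 0$ such that for all $w\in\mathrm{dom}(F)$, $\frac1n\sum_{i=1}^n\|\nabla f(w;i)-\nabla F(w)\|^2\le\Theta\|\nabla F(w)\|^2+\sigma^2$. Let $0\le\beta<1$ and $K:=\max\left\{\frac52,\frac{9(5-3\beta)(\Theta+1)}{1-\beta}\right\}$. Fix the number of epochs $T\ge1$ and run the SMG algorithm (described in the context), with any choice of permutations $\pi^{(t)}$, momentum weight $\beta$, and constant learning rate $\eta_t:=\frac{\gamma}{T^{1/3}}$ for some $\gamma>0$ such that $\frac{\gamma}{T^{1/3}}\le\frac{1}{L\sqrt K}$. Then $$\mathbb{E}\big[\|\nabla F(\hat w_T)\|^2\big]\le\frac{1}{T^{2/3}}\left(\frac{4[F(\tilde w_0)-F_*]}{(1-\beta)\gamma}+\frac{9\sigma^2(5-3\beta)L^2\gamma^2}{1-\beta}\right).$$ Consequently, the convergence rate of the algorithm is $\mathcal{O}(T^{-2/3})$ in the number of epochs $T$.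
   Context: $[n]=\{1,\dots,n\}$; $\|\cdot\|$ is the Euclidean norm; $\mathbb{E}$ is expectation over all randomness (permutations, if random, and output). Since each $f(\cdot;i)$ is real-valued on $\mathbb{R}^d$, $\mathrm{dom}(F)=\mathbb{R}^d$; each $f(\cdot;i)$ is differentiable. SMG algorithm (Shuffling Momentum Gradient), with parameters $\beta$, number of epochs $T\ge1$, and $\eta_t$: Choose $\tilde w_0\in\mathbb{R}^d$ (deterministic) and set $\tilde m_0:=0$. For $t=1,\dots,T$: set $w_0^{(t)}:=\tilde w_{t-1}$, $m_0^{(t)}:=\tilde m_{t-1}$, $v_0^{(t)}:=0$; generate an arbitrary deterministic or random permutation $\pi^{(t)}$ of $[n]$; for $i=0,\dots,n-1$ put $g_i^{(t)}:=\nabla f(w_i^{(t)};\pi^{(t)}(i+1))$ and $$m_{i+1}^{(t)}:=\beta m_0^{(t)}+(1-\beta)g_i^{(t)},\quad v_{i+1}^{(t)}:=v_i^{(t)}+\tfrac1n g_i^{(t)},\quad w_{i+1}^{(t)}:=w_i^{(t)}-\tfrac{\eta_t}{n}m_{i+1}^{(t)};$$ then set $\tilde w_t:=w_n^{(t)}$ and $\tilde m_t:=v_n^{(t)}$. Output: $\hat w_T\in\{\tilde w_0,\dots,\tilde w_{T-1}\}$ chosen at random (independently of the permutations) with probability $\mathbb{P}[\hat w_T=\tilde w_{t-1}]=\eta_t/\sum_{s=1}^T\eta_s$. *)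

theory Defs
  imports "HOL-Probability.Probability" "HOL-Library.Landau_Symbols"
begin

definition gradient :: "('a::real_inner \<Rightarrow> real) \<Rightarrow> 'a \<Rightarrow> 'a" where
  "gradient g w = (THE D. GDERIV g w :> D)"

lemma gradient_eqI: "GDERIV g w :> D \<Longrightarrow> gradient g w = D"
  unfolding gradient_def
proof (rule the_equality)
  fix E assume "GDERIV g w :> D" "GDERIV g w :> E"
  then have "(\<lambda>h. h \<bullet> E) = (\<lambda>h. h \<bullet> D)"
    unfolding gderiv_def by (rule has_derivative_unique[rotated])
  then have "(E - D) \<bullet> (E - D) = 0"
    by (metis inner_diff_right diff_self)
  then show "E = D" by simp
qed

lemma GDERIV_gradient:
  fixes g :: "'a::euclidean_space \<Rightarrow> real"
  assumes "g differentiable (at w)"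
  shows "GDERIV g w :> gradient g w"
proof -
  obtain g' where g': "(g has_derivative g') (at w)"
    using assms unfolding differentiable_def by blast
  interpret bounded_linear g' using g' by (rule has_derivative_bounded_linear)
  have "g' h = h \<bullet> (\<Sum>b\<in>Basis. g' b *\<^sub>R b)" for h
    by (subst euclidean_representation[of h, symmetric])
       (simp add: sum scaleR inner_sum_right mult.commute)
  then have "g' = (\<lambda>h. h \<bullet> (\<Sum>b\<in>Basis. g' b *\<^sub>R b))" by blast
  with g' have "GDERIV g w :> (\<Sum>b\<in>Basis. g' b *\<^sub>R b)"
    unfolding gderiv_def by metis
  with gradient_eqI show ?thesis by metis
qed

definition avg_objective :: "(nat \<Rightarrow> 'a \<Rightarrow> real) \<Rightarrow> nat \<Rightarrow> 'a \<Rightarrow> real" where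
  "avg_objective f n w = (1 / real n) * (\<Sum>i=1..n. f i w)"

text \<open>
  The value after \<open>i\<close> inner steps of one epoch is the triple of the iterate, the momentum and
  the running gradient average. Every step mixes in the momentum \<open>m0\<close> from the start of the
  epoch, not the one of the preceding step.
\<close>

primrec smg_inner ::
  "(nat \<Rightarrow> 'a::euclidean_space \<Rightarrow> real) \<Rightarrow> nat \<Rightarrow> real \<Rightarrow> real \<Rightarrow> (nat \<Rightarrow> nat) \<Rightarrow>
    'a \<Rightarrow> 'a \<Rightarrow> nat \<Rightarrow> 'a \<times> 'a \<times> 'a" where
  "smg_inner f n \<beta> h p w0 m0 0 = (w0, m0, 0)"
| "smg_inner f n \<beta> h p w0 m0 (Suc i) =
    (let (w, m, v) = smg_inner f n \<beta> h p w0 m0 i;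
         g = gradient (f (p (i + 1))) w;
         m' = \<beta> *\<^sub>R m0 + (1 - \<beta>) *\<^sub>R g
     in (w - (h / real n) *\<^sub>R m', m', v + (1 / real n) *\<^sub>R g))"

text \<open>
  The momentum carried over to the next epoch is the final gradient average, not the final
  inner momentum.
\<close>

primrec smg_epochs ::
  "(nat \<Rightarrow> 'a::euclidean_space \<Rightarrow> real) \<Rightarrow> nat \<Rightarrow> real \<Rightarrow> (nat \<Rightarrow> real) \<Rightarrow> (nat \<Rightarrow> nat \<Rightarrow> nat) \<Rightarrow>
    'a \<Rightarrow> nat \<Rightarrow> 'a \<times> 'a" where
  "smg_epochs f n \<beta> \<eta> p w0 0 = (w0, 0)"
| "smg_epochs f n \<beta> \<eta> p w0 (Suc t) =
    (let (w, m) = smg_epochs f n \<beta> \<eta> p w0 t;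
         (w', _, v') = smg_inner f n \<beta> (\<eta> (Suc t)) (p (Suc t)) w m n
     in (w', v'))"

definition smg_iterate ::
  "(nat \<Rightarrow> 'a::euclidean_space \<Rightarrow> real) \<Rightarrow> nat \<Rightarrow> real \<Rightarrow> (nat \<Rightarrow> real) \<Rightarrow> (nat \<Rightarrow> nat \<Rightarrow> nat) \<Rightarrow>
    'a \<Rightarrow> nat \<Rightarrow> 'a" where
  "smg_iterate f n \<beta> \<eta> p w0 t = fst (smg_epochs f n \<beta> \<eta> p w0 t)"

text \<open>
  The randomness of a run with \<open>T\<close> epochs: \<open>p t\<close> is the permutation used in epoch \<open>t\<close> and
  \<open>\<tau>\<close> is the random index for which the output is the iterate after \<open>\<tau> - 1\<close> epochs. The joint
  law of the permutations is arbitrary; they may depend on each other and may be constant.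
  The index \<open>\<tau>\<close> is independent of the whole family of permutations; \<open>indep_var\<close> does not
  apply because it needs two random variables of the same type, hence the generated
  sigma-algebras.
\<close>

locale smg_randomness = prob_space M
  for M :: "'w measure" +
  fixes n T :: nat
    and \<eta> :: "nat \<Rightarrow> real"
    and p :: "nat \<Rightarrow> 'w \<Rightarrow> nat \<Rightarrow> nat"
    and \<tau> :: "'w \<Rightarrow> nat"
  assumes perm: "\<And>t. t \<in> {1..T} \<Longrightarrow> p t \<in> M \<rightarrow>\<^sub>M count_space {q. q permutes {1..n}}"
    and index: "\<tau> \<in> M \<rightarrow>\<^sub>M count_space {1..T}"
    and index_prob:
      "\<And>t. t \<in> {1..T} \<Longrightarrow> \<P>(\<omega> in M. \<tau> \<omega> = t) = \<eta> t / (\<Sum>s=1..T. \<eta> s)"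
    and index_indep:
      "indep_set {\<tau> -` A \<inter> space M | A. A \<in> sets (count_space {1..T})}
        {(\<lambda>\<omega>. \<lambda>t\<in>{1..T}. p t \<omega>) -` A \<inter> space M | A.
          A \<in> sets (Pi\<^sub>M {1..T} (\<lambda>_. count_space {q. q permutes {1..n}}))}"

definition smg_output ::
  "(nat \<Rightarrow> 'a::euclidean_space \<Rightarrow> real) \<Rightarrow> nat \<Rightarrow> real \<Rightarrow> (nat \<Rightarrow> real) \<Rightarrow>
    (nat \<Rightarrow> 'w \<Rightarrow> nat \<Rightarrow> nat) \<Rightarrow> ('w \<Rightarrow> nat) \<Rightarrow> 'a \<Rightarrow> 'w \<Rightarrow> 'a" where
  "smg_output f n \<beta> \<eta> p \<tau> w0 \<omega> = smg_iterate f n \<beta> \<eta> (\<lambda>t. p t \<omega>) w0 (\<tau> \<omega> - 1)"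

end

theory Submission
  imports Defs "HOL-Real_Asymp.Real_Asymp"
begin

text \<open>
  Write \<open>w\<^sub>t\<close> for the iterate and \<open>m\<^sub>t\<close> for the momentum after \<open>t\<close> epochs, and \<open>h\<close> for the constant
  learning rate. One whole epoch is a single step
  \<open>w\<^sub>t\<^sub>+\<^sub>1 = w\<^sub>t - h (\<beta> m\<^sub>t + (1 - \<beta>) m\<^sub>t\<^sub>+\<^sub>1)\<close>, where \<open>m\<^sub>t\<^sub>+\<^sub>1\<close> is the average of the gradients met during
  the epoch. A permutation visits each component exactly once, so if the inner iterates
  did not move, \<open>m\<^sub>t\<^sub>+\<^sub>1\<close> would be the full gradient at \<open>w\<^sub>t\<close>. Hence the method is gradient descent with an
  error, and by smoothness (\<open>epoch_descent\<close>)
  \<open>F w\<^sub>t\<^sub>+\<^sub>1 \<le> F w\<^sub>t - h/2 |\<nabla>F w\<^sub>t|\<^sup>2 + h/2 (\<beta> |m\<^sub>t - \<nabla>F w\<^sub>t|\<^sup>2 + (1 - \<beta>) |m\<^sub>t\<^sub>+\<^sub>1 - \<nabla>F w\<^sub>t|\<^sup>2)\<close>.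

  Both errors are caused only by the movement of the inner iterates: \<open>m\<^sub>t\<^sub>+\<^sub>1\<close> is compared with the
  gradient at the start of its own epoch, \<open>m\<^sub>t\<close> with the gradient at the end of its own epoch
  (\<open>moving_gradient_error\<close>). Any two inner iterates of an epoch have squared distance at most
  \<open>h\<^sup>2\<close> times a combination of \<open>|m\<^sub>t|\<^sup>2\<close>, \<open>|\<nabla>F w\<^sub>t|\<^sup>2\<close>, \<open>\<sigma>\<^sup>2\<close> and the mean squared movement itself
  (\<open>epoch_distance\<close>). Summed over all epochs, the step size condition makes \<open>L\<^sup>2 h\<^sup>2\<close> so small that
  the errors are absorbed by the gradient terms, except for the contribution of \<open>\<sigma>\<^sup>2\<close>
  (\<open>accumulated_descent\<close>). The momentum of the first epoch is \<open>0\<close>, with error \<open>|\<nabla>F w\<^sub>0|\<^sup>2\<close>; this is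
  why only the fraction \<open>1 - \<beta>\<close> of the descent survives.

  The resulting bound on the average of \<open>|\<nabla>F w\<^sub>t|\<^sup>2\<close> holds for every fixed choice of permutations.
  As the output index is uniform and independent of the permutations, the expectation in question
  is an expectation of such averages (\<open>expectation_output_le\<close>). With \<open>h\<close> of order \<open>T powr (-1/3)\<close>,
  the two terms of the bound, of orders \<open>1 / (h T)\<close> and \<open>h\<^sup>2\<close>, are balanced.
\<close>

section \<open>Squared norms of averages\<close>

lemma norm_sum_squared_le:
  fixes y :: "'b \<Rightarrow> 'a::real_normed_vector"
  shows "(norm (\<Sum>k\<in>S. y k))\<^sup>2 \<le> real (card S) * (\<Sum>k\<in>S. (norm (y k))\<^sup>2)"
proof -
  have "(norm (\<Sum>k\<in>S. y k))\<^sup>2 \<le> (\<Sum>k\<in>S. norm (y k))\<^sup>2"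
    by (intro power_mono norm_sum) auto
  also have "\<dots> \<le> (\<Sum>k\<in>S. (norm (y k))\<^sup>2) * real (card S)"
    by (rule sum_squared_le_sum_of_squares)
  finally show ?thesis by (simp add: mult.commute)
qed

lemma norm_average_squared_le:
  fixes y :: "nat \<Rightarrow> 'a::real_normed_vector"
  shows "(norm (\<Sum>k<n. (1 / real n) *\<^sub>R y k))\<^sup>2 \<le> (1 / real n) * (\<Sum>k<n. (norm (y k))\<^sup>2)"
proof -
  have "(norm (\<Sum>k<n. (1 / real n) *\<^sub>R y k))\<^sup>2
      \<le> real (card {..<n}) * (\<Sum>k<n. (norm ((1 / real n) *\<^sub>R y k))\<^sup>2)"
    by (rule norm_sum_squared_le)
  also have "\<dots> = (1 / real n) * (\<Sum>k<n. (norm (y k))\<^sup>2)"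
    by (cases "n = 0")
       (simp_all add: power_divide sum_divide_distrib [symmetric] power2_eq_square)
  finally show ?thesis .
qed

lemma norm_convex_combination_squared_le:
  fixes x y :: "'a::real_inner"
  assumes "0 \<le> \<beta>" "\<beta> \<le> 1"
  shows "(norm (\<beta> *\<^sub>R x + (1 - \<beta>) *\<^sub>R y))\<^sup>2 \<le> \<beta> * (norm x)\<^sup>2 + (1 - \<beta>) * (norm y)\<^sup>2"
proof -
  have "\<beta> * (norm x)\<^sup>2 + (1 - \<beta>) * (norm y)\<^sup>2 - (norm (\<beta> *\<^sub>R x + (1 - \<beta>) *\<^sub>R y))\<^sup>2
      = \<beta> * (1 - \<beta>) * (norm (x - y))\<^sup>2"
    unfolding power2_norm_eq_inner
    by (simp add: inner_commute algebra_simps)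
  moreover have "\<dots> \<ge> 0" using assms by simp
  ultimately show ?thesis by linarith
qed

lemma norm_add3_squared_le:
  fixes x y z :: "'a::real_normed_vector"
  shows "(norm (x + y + z))\<^sup>2 \<le> 3 * ((norm x)\<^sup>2 + (norm y)\<^sup>2 + (norm z)\<^sup>2)"
  using norm_sum_squared_le [of "\<lambda>k::nat. [x, y, z] ! k" "{0, 1, 2}"] by (simp add: add.assoc)

lemma norm_squared_le_twice:
  fixes x y :: "'a::real_normed_vector"
  shows "(norm x)\<^sup>2 \<le> 2 * ((norm y)\<^sup>2 + (norm (x - y))\<^sup>2)"
  using norm_sum_squared_le [of "\<lambda>k::nat. [y, x - y] ! k" "{0, 1}"] by simp


section \<open>Smooth averages with bounded gradient variance\<close>

text \<open>
  The objective is the average of \<open>n\<close> differentiable components whose gradients are Lipschitz with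
  a common constant \<open>L\<close>. The mean squared deviation of the component gradients from the full
  gradient grows at most like the squared norm of the latter.
\<close>

locale smooth_average =
  fixes f :: "nat \<Rightarrow> 'a::euclidean_space \<Rightarrow> real"
    and n :: nat
    and L \<Theta> \<sigma> :: real
  assumes n: "n \<ge> 1"
    and differentiable: "\<And>i w. i \<in> {1..n} \<Longrightarrow> f i differentiable (at w)"
    and L: "L > 0"
    and smooth: "\<And>i w w'. i \<in> {1..n} \<Longrightarrow>
      norm (gradient (f i) w - gradient (f i) w') \<le> L * norm (w - w')"
    and Theta: "\<Theta> \<ge> 0"
    and variance: "\<And>w. (1 / real n) *
        (\<Sum>i=1..n. (norm (gradient (f i) w - gradient (avg_objective f n) w))\<^sup>2)
      \<le> \<Theta> * (norm (gradient (avg_objective f n) w))\<^sup>2 + \<sigma>\<^sup>2"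
begin

abbreviation F :: "'a \<Rightarrow> real" where
  "F \<equiv> avg_objective f n"

lemma GDERIV_average: "GDERIV F w :> (1 / real n) *\<^sub>R (\<Sum>i=1..n. gradient (f i) w)"
proof -
  have *: "(f i has_derivative (\<lambda>h. h \<bullet> gradient (f i) w)) (at w)" if "i \<in> {1..n}" for i
    using GDERIV_gradient [OF differentiable [OF that]] by (simp add: gderiv_def)
  have "((\<lambda>w. (1 / real n) * (\<Sum>i=1..n. f i w)) has_derivative
      (\<lambda>h. (1 / real n) * (\<Sum>i=1..n. h \<bullet> gradient (f i) w))) (at w)"
    by (intro has_derivative_mult_right has_derivative_sum *)
  then show ?thesis
    unfolding gderiv_def avg_objective_def [abs_def]
    by (simp add: inner_sum_right)
qed

lemma gradient_average: "gradient F w = (1 / real n) *\<^sub>R (\<Sum>i=1..n. gradient (f i) w)"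
  by (rule gradient_eqI [OF GDERIV_average])

lemma GDERIV_F: "GDERIV F w :> gradient F w"
  using GDERIV_average by (simp add: gradient_average)

lemma sum_permuted:
  fixes g :: "nat \<Rightarrow> 'b::comm_monoid_add"
  assumes "p permutes {1..n}"
  shows "(\<Sum>k<n. g (p (k + 1))) = (\<Sum>i=1..n. g i)"
proof -
  have "(\<Sum>i=1..n. g i) = (\<Sum>i=1..n. g (p i))"
    using sum.permute [OF assms, of g] by (simp add: o_def)
  also have "\<dots> = (\<Sum>k<n. g (p (k + 1)))"
    by (rule sum.reindex_bij_witness [of _ "\<lambda>k. k + 1" "\<lambda>i. i - 1"]) auto
  finally show ?thesis by simp
qed

lemma permuted_index: "p permutes {1..n} \<Longrightarrow> k < n \<Longrightarrow> p (k + 1) \<in> {1..n}"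
  by (subst permutes_in_image) auto

lemma gradient_average_permuted:
  assumes "p permutes {1..n}"
  shows "gradient F w = (\<Sum>k<n. (1 / real n) *\<^sub>R gradient (f (p (k + 1))) w)"
  using sum_permuted [OF assms, of "\<lambda>i. gradient (f i) w"]
  by (simp only: gradient_average scaleR_right.sum [symmetric])

text \<open>
  Incremental gradients taken at moving points \<open>x k\<close> instead of a common point \<open>y\<close>: the error
  of their average is controlled by the mean squared distance of the \<open>x k\<close> from \<open>y\<close>.
\<close>

lemma moving_gradient_error:
  assumes p: "p permutes {1..n}"
  shows "(norm ((\<Sum>k<n. (1 / real n) *\<^sub>R gradient (f (p (k + 1))) (x k)) - gradient F y))\<^sup>2
    \<le> L\<^sup>2 * ((1 / real n) * (\<Sum>k<n. (norm (x k - y))\<^sup>2))"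
proof -
  have "(\<Sum>k<n. (1 / real n) *\<^sub>R gradient (f (p (k + 1))) (x k)) - gradient F y
      = (\<Sum>k<n. (1 / real n) *\<^sub>R (gradient (f (p (k + 1))) (x k) - gradient (f (p (k + 1))) y))"
    by (simp add: gradient_average_permuted [OF p] sum_subtractf scaleR_diff_right)
  then have "(norm ((\<Sum>k<n. (1 / real n) *\<^sub>R gradient (f (p (k + 1))) (x k)) - gradient F y))\<^sup>2
      \<le> (1 / real n) * (\<Sum>k<n. (norm (gradient (f (p (k + 1))) (x k) - gradient (f (p (k + 1))) y))\<^sup>2)"
    by (simp only: norm_average_squared_le)
  also have "\<dots> \<le> (1 / real n) * (\<Sum>k<n. (L * norm (x k - y))\<^sup>2)"
    by (intro mult_left_mono sum_mono power_mono smooth permuted_index [OF p]) auto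
  also have "\<dots> = L\<^sup>2 * ((1 / real n) * (\<Sum>k<n. (norm (x k - y))\<^sup>2))"
    by (simp add: power_mult_distrib sum_distrib_left mult_ac)
  finally show ?thesis .
qed

text \<open>
  The size of the incremental gradients splits into the movement of the points, the variance of the
  components and the full gradient.
\<close>

lemma moving_gradient_size:
  assumes p: "p permutes {1..n}"
  shows "(1 / real n) * (\<Sum>k<n. (norm (gradient (f (p (k + 1))) (x k)))\<^sup>2)
    \<le> 3 * (L\<^sup>2 * ((1 / real n) * (\<Sum>k<n. (norm (x k - y))\<^sup>2))
            + (\<Theta> + 1) * (norm (gradient F y))\<^sup>2 + \<sigma>\<^sup>2)"
proof -
  let ?g = "\<lambda>k. gradient (f (p (k + 1)))"
  let ?G = "(norm (gradient F y))\<^sup>2"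
  have single: "(norm (?g k (x k)))\<^sup>2
      \<le> 3 * (L\<^sup>2 * (norm (x k - y))\<^sup>2 + (norm (?g k y - gradient F y))\<^sup>2 + ?G)" if "k < n" for k
  proof -
    have "(norm (?g k (x k) - ?g k y))\<^sup>2 \<le> (L * norm (x k - y))\<^sup>2"
      by (intro power_mono smooth permuted_index [OF p that]) auto
    then show ?thesis
      using norm_add3_squared_le [of "?g k (x k) - ?g k y" "?g k y - gradient F y" "gradient F y"]
      by (simp add: power_mult_distrib)
  qed
  have "(1 / real n) * (\<Sum>k<n. (norm (?g k (x k)))\<^sup>2)
      \<le> (1 / real n) *
        (\<Sum>k<n. 3 * (L\<^sup>2 * (norm (x k - y))\<^sup>2 + (norm (?g k y - gradient F y))\<^sup>2 + ?G))"
    by (intro mult_left_mono sum_mono single) auto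
  also have "\<dots> = 3 * (L\<^sup>2 * ((1 / real n) * (\<Sum>k<n. (norm (x k - y))\<^sup>2))
      + (1 / real n) * (\<Sum>k<n. (norm (?g k y - gradient F y))\<^sup>2) + ?G)"
    using n by (simp add: sum.distrib sum_distrib_left [symmetric] field_simps)
  also have "(\<Sum>k<n. (norm (?g k y - gradient F y))\<^sup>2)
      = (\<Sum>i=1..n. (norm (gradient (f i) y - gradient F y))\<^sup>2)"
    by (rule sum_permuted [OF p, of "\<lambda>i. (norm (gradient (f i) y - gradient F y))\<^sup>2"])
  finally show ?thesis
    using variance [of y] by (simp add: algebra_simps)
qed

lemma smooth_F: "norm (gradient F w - gradient F w') \<le> L * norm (w - w')"
proof -
  have "norm (gradient F w - gradient F w')
      = (1 / real n) * norm (\<Sum>i=1..n. gradient (f i) w - gradient (f i) w')"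
    by (simp add: gradient_average sum_subtractf scaleR_diff_right [symmetric])
  also have "\<dots> \<le> (1 / real n) * (\<Sum>i=1..n. L * norm (w - w'))"
    by (intro mult_left_mono order_trans [OF norm_sum] sum_mono smooth) auto
  also have "\<dots> = L * norm (w - w')"
    using n by simp
  finally show ?thesis .
qed

text \<open>
  Up to a constant, the function \<open>\<phi>\<close> of the proof is the left side minus the right side along the
  segment from \<open>w\<close> to \<open>w + z\<close>; its derivative is nonpositive by the Lipschitz condition.
\<close>

lemma quadratic_upper_bound: "F (w + z) \<le> F w + z \<bullet> gradient F w + L / 2 * (norm z)\<^sup>2"
proof -
  define \<phi> where "\<phi> u = F (w + u *\<^sub>R z) - u * (z \<bullet> gradient F w) - L / 2 * u\<^sup>2 * (norm z)\<^sup>2"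
    for u :: real
  have "\<phi> 1 \<le> \<phi> 0"
  proof (rule DERIV_nonpos_imp_nonincreasing [where f = \<phi>])
    fix u :: real
    assume u: "0 \<le> u" "u \<le> 1"
    let ?D = "z \<bullet> gradient F (w + u *\<^sub>R z)"
    have "((\<lambda>u. F (w + u *\<^sub>R z)) has_derivative
        (\<lambda>h. (h *\<^sub>R z) \<bullet> gradient F (w + u *\<^sub>R z))) (at u)"
    proof (rule has_derivative_compose [where g = F])
      show "((\<lambda>u. w + u *\<^sub>R z) has_derivative (\<lambda>h. h *\<^sub>R z)) (at u)"
        by (auto intro!: derivative_eq_intros)
      show "(F has_derivative (\<lambda>h. h \<bullet> gradient F (w + u *\<^sub>R z))) (at (w + u *\<^sub>R z))"
        using GDERIV_F by (simp add: gderiv_def)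
    qed
    then have "((\<lambda>u. F (w + u *\<^sub>R z)) has_real_derivative ?D) (at u)"
      by (simp add: has_field_derivative_def mult_commute_abs)
    then have "(\<phi> has_real_derivative ?D - z \<bullet> gradient F w - L * u * (norm z)\<^sup>2) (at u)"
      unfolding \<phi>_def by (auto intro!: derivative_eq_intros)
    moreover have "?D - z \<bullet> gradient F w \<le> L * u * (norm z)\<^sup>2"
    proof -
      have "?D - z \<bullet> gradient F w \<le> norm z * norm (gradient F (w + u *\<^sub>R z) - gradient F w)"
        by (metis inner_diff_right norm_cauchy_schwarz)
      also have "\<dots> \<le> norm z * (L * norm (u *\<^sub>R z))"
        using smooth_F [of "w + u *\<^sub>R z" w] by (intro mult_left_mono) auto
      finally show ?thesis using u by (simp add: power2_eq_square mult_ac)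
    qed
    ultimately show "\<exists>d. (\<phi> has_real_derivative d) (at u) \<and> d \<le> 0"
      by (intro exI conjI) auto
  qed simp
  then show ?thesis by (simp add: \<phi>_def)
qed

text \<open>A step along an approximation \<open>d\<close> of the gradient decreases \<open>F\<close> up to the squared error.\<close>

lemma inexact_gradient_step:
  assumes h: "0 \<le> h" "L * h \<le> 1"
  shows "F (w - h *\<^sub>R d) \<le> F w - h / 2 * (norm (gradient F w))\<^sup>2
    + h / 2 * (norm (d - gradient F w))\<^sup>2"
proof -
  have "F (w - h *\<^sub>R d) \<le> F w - h * (d \<bullet> gradient F w) + h * (L * h) / 2 * (norm d)\<^sup>2"
    using quadratic_upper_bound [of w "- h *\<^sub>R d"] h
    by (simp add: power_mult_distrib power2_eq_square mult_ac)
  moreover have "h * (L * h) / 2 * (norm d)\<^sup>2 \<le> h / 2 * (norm d)\<^sup>2"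
    using mult_left_mono [OF h(2) h(1)] by (intro mult_right_mono) auto
  moreover have "h * (d \<bullet> gradient F w) = h / 2 * (norm (gradient F w))\<^sup>2 + h / 2 * (norm d)\<^sup>2
      - h / 2 * (norm (d - gradient F w))\<^sup>2"
    unfolding power2_norm_eq_inner by (simp add: inner_commute algebra_simps)
  ultimately show ?thesis by linarith
qed

end

section \<open>One epoch\<close>

lemma smg_inner_Suc:
  "fst (smg_inner f n \<beta> h p w m (Suc i)) = fst (smg_inner f n \<beta> h p w m i)
    - (h / real n) *\<^sub>R (\<beta> *\<^sub>R m
        + (1 - \<beta>) *\<^sub>R gradient (f (p (i + 1))) (fst (smg_inner f n \<beta> h p w m i)))"
  by (simp add: Let_def split_beta)

lemma smg_inner_average:
  "snd (snd (smg_inner f n \<beta> h p w m i))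
    = (\<Sum>k<i. (1 / real n) *\<^sub>R gradient (f (p (k + 1))) (fst (smg_inner f n \<beta> h p w m k)))"
  by (induction i) (simp_all add: Let_def split_beta)

lemma smg_inner_displacement:
  assumes "i \<le> j"
  shows "fst (smg_inner f n \<beta> h p w m j) - fst (smg_inner f n \<beta> h p w m i)
    = - (h / real n) *\<^sub>R (\<Sum>k=i..<j. \<beta> *\<^sub>R m
        + (1 - \<beta>) *\<^sub>R gradient (f (p (k + 1))) (fst (smg_inner f n \<beta> h p w m k)))"
  using assms
proof (induction j rule: dec_induct)
  case base
  show ?case by simp
next
  case (step j)
  then show ?case by (simp add: smg_inner_Suc scaleR_add_right del: smg_inner.simps)
qed

lemma smg_inner_final:
  assumes "n \<ge> 1"
  shows "fst (smg_inner f n \<beta> h p w m n)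
    = w - h *\<^sub>R (\<beta> *\<^sub>R m + (1 - \<beta>) *\<^sub>R snd (snd (smg_inner f n \<beta> h p w m n)))"
proof -
  let ?g = "\<lambda>k. gradient (f (p (k + 1))) (fst (smg_inner f n \<beta> h p w m k))"
  have "(1 / real n) *\<^sub>R (\<Sum>k<n. \<beta> *\<^sub>R m + (1 - \<beta>) *\<^sub>R ?g k)
      = \<beta> *\<^sub>R m + (1 - \<beta>) *\<^sub>R snd (snd (smg_inner f n \<beta> h p w m n))"
    using assms
    by (simp add: smg_inner_average sum.distrib scaleR_right.sum [symmetric]
        sum_constant_scaleR scaleR_add_right)
  moreover have "fst (smg_inner f n \<beta> h p w m n) - w
      = - h *\<^sub>R ((1 / real n) *\<^sub>R (\<Sum>k<n. \<beta> *\<^sub>R m + (1 - \<beta>) *\<^sub>R ?g k))"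
    using smg_inner_displacement [of 0 n f n \<beta> h p w m] by (simp add: atLeast0LessThan)
  ultimately show ?thesis by (simp add: diff_eq_eq)
qed

text \<open>
  The drift of an epoch that starts at \<open>w\<close> with momentum \<open>m\<close> is the mean squared distance of the
  inner iterates from \<open>w\<close>. The factor \<open>L\<^sup>2\<close> makes it comparable with squared gradient errors.
\<close>

definition epoch_drift ::
  "(nat \<Rightarrow> 'a::euclidean_space \<Rightarrow> real) \<Rightarrow> nat \<Rightarrow> real \<Rightarrow> real \<Rightarrow> real \<Rightarrow> (nat \<Rightarrow> nat) \<Rightarrow> 'a \<Rightarrow> 'a \<Rightarrow> real" where
  "epoch_drift f n L \<beta> h p w m
    = L\<^sup>2 * ((1 / real n) * (\<Sum>k<n. (norm (fst (smg_inner f n \<beta> h p w m k) - w))\<^sup>2))"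

context smooth_average
begin

text \<open>
  The squared norm of any partial sum of the \<open>n\<close> inner steps is at most \<open>n\<close> times the sum of the
  squared norms of all of them. The
  bound therefore does not depend on \<open>i\<close> and \<open>j\<close>, and the same expression controls distances from
  the start and from the end of the epoch.
\<close>

lemma epoch_distance:
  assumes p: "p permutes {1..n}" and \<beta>: "0 \<le> \<beta>" "\<beta> \<le> 1" and ij: "i \<le> j" "j \<le> n"
  shows "(norm (fst (smg_inner f n \<beta> h p w m j) - fst (smg_inner f n \<beta> h p w m i)))\<^sup>2
    \<le> h\<^sup>2 * (\<beta> * (norm m)\<^sup>2 + 3 * (1 - \<beta>) *
        (epoch_drift f n L \<beta> h p w m + (\<Theta> + 1) * (norm (gradient F w))\<^sup>2 + \<sigma>\<^sup>2))"
proof -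
  define x where "x k = fst (smg_inner f n \<beta> h p w m k)" for k
  define g where "g k = gradient (f (p (k + 1))) (x k)" for k
  define X where "X = epoch_drift f n L \<beta> h p w m + (\<Theta> + 1) * (norm (gradient F w))\<^sup>2 + \<sigma>\<^sup>2"
  define y where "y k = \<beta> *\<^sub>R m + (1 - \<beta>) *\<^sub>R g k" for k
  have "(norm (x j - x i))\<^sup>2 = (h / real n)\<^sup>2 * (norm (\<Sum>k=i..<j. y k))\<^sup>2"
    using smg_inner_displacement [OF ij(1), of f n \<beta> h p w m]
    by (simp only: x_def [symmetric] g_def [symmetric] y_def [symmetric] norm_scaleR
        power_mult_distrib power2_abs power2_minus)
  also have "\<dots> \<le> (h / real n)\<^sup>2 * (real (card {i..<j}) * (\<Sum>k=i..<j. (norm (y k))\<^sup>2))"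
    by (intro mult_left_mono norm_sum_squared_le) auto
  also have "\<dots> \<le> (h / real n)\<^sup>2 * (real n * (\<Sum>k<n. (norm (y k))\<^sup>2))"
    using ij by (intro mult_left_mono mult_mono sum_mono2) (auto intro!: sum_nonneg)
  also have "\<dots> = h\<^sup>2 * ((1 / real n) * (\<Sum>k<n. (norm (y k))\<^sup>2))"
    using n by (simp add: power2_eq_square)
  also have "(1 / real n) * (\<Sum>k<n. (norm (y k))\<^sup>2)
      \<le> (1 / real n) * (\<Sum>k<n. \<beta> * (norm m)\<^sup>2 + (1 - \<beta>) * (norm (g k))\<^sup>2)"
    unfolding y_def
    by (intro mult_left_mono sum_mono norm_convex_combination_squared_le \<beta>) auto
  also have "\<dots> = \<beta> * (norm m)\<^sup>2 + (1 - \<beta>) * ((1 / real n) * (\<Sum>k<n. (norm (g k))\<^sup>2))"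
    using n by (simp add: sum.distrib sum_distrib_left [symmetric] distrib_left)
  also have "\<dots> \<le> \<beta> * (norm m)\<^sup>2 + (1 - \<beta>) * (3 * X)"
    using moving_gradient_size [OF p, of x w] \<beta>
    by (intro add_left_mono mult_left_mono) (simp_all add: X_def epoch_drift_def x_def g_def)
  also have "\<dots> = \<beta> * (norm m)\<^sup>2 + 3 * (1 - \<beta>) * X"
    by simp
  finally show ?thesis
    by (simp add: x_def X_def mult_left_mono)
qed

lemma epoch_drift_le:
  assumes p: "p permutes {1..n}" and \<beta>: "0 \<le> \<beta>" "\<beta> \<le> 1"
  shows "epoch_drift f n L \<beta> h p w m
    \<le> L\<^sup>2 * h\<^sup>2 * (\<beta> * (norm m)\<^sup>2 + 3 * (1 - \<beta>) *
        (epoch_drift f n L \<beta> h p w m + (\<Theta> + 1) * (norm (gradient F w))\<^sup>2 + \<sigma>\<^sup>2))"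
    (is "_ \<le> L\<^sup>2 * h\<^sup>2 * ?D")
proof -
  have "(1 / real n) * (\<Sum>k<n. (norm (fst (smg_inner f n \<beta> h p w m k) - w))\<^sup>2)
      \<le> (1 / real n) * (\<Sum>k<n. h\<^sup>2 * ?D)"
    using epoch_distance [OF p \<beta>, of 0 _ h w m] by (intro mult_left_mono sum_mono) auto
  also have "\<dots> = h\<^sup>2 * ?D" using n by simp
  finally have "L\<^sup>2 * ((1 / real n) * (\<Sum>k<n. (norm (fst (smg_inner f n \<beta> h p w m k) - w))\<^sup>2))
      \<le> L\<^sup>2 * (h\<^sup>2 * ?D)"
    by (rule mult_left_mono) simp
  then show ?thesis
    by (subst epoch_drift_def) (simp only: mult.assoc)
qed

text \<open>
  The average gradient of an epoch approximates the full gradient at the starting point and at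
  the final point, where the next epoch uses it as momentum.
\<close>

lemma epoch_average_error_start:
  assumes "p permutes {1..n}"
  shows "(norm (snd (snd (smg_inner f n \<beta> h p w m n)) - gradient F w))\<^sup>2
    \<le> epoch_drift f n L \<beta> h p w m"
  unfolding smg_inner_average epoch_drift_def by (rule moving_gradient_error [OF assms])

lemma epoch_average_error_end:
  assumes p: "p permutes {1..n}" and \<beta>: "0 \<le> \<beta>" "\<beta> \<le> 1"
  shows "(norm (snd (snd (smg_inner f n \<beta> h p w m n))
      - gradient F (fst (smg_inner f n \<beta> h p w m n))))\<^sup>2
    \<le> L\<^sup>2 * h\<^sup>2 * (\<beta> * (norm m)\<^sup>2 + 3 * (1 - \<beta>) *
        (epoch_drift f n L \<beta> h p w m + (\<Theta> + 1) * (norm (gradient F w))\<^sup>2 + \<sigma>\<^sup>2))"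
    (is "_ \<le> L\<^sup>2 * h\<^sup>2 * ?D")
proof -
  let ?x = "\<lambda>k. fst (smg_inner f n \<beta> h p w m k)"
  have "(norm (snd (snd (smg_inner f n \<beta> h p w m n)) - gradient F (?x n)))\<^sup>2
      \<le> L\<^sup>2 * ((1 / real n) * (\<Sum>k<n. (norm (?x k - ?x n))\<^sup>2))"
    unfolding smg_inner_average by (rule moving_gradient_error [OF p])
  also have "\<dots> \<le> L\<^sup>2 * ((1 / real n) * (\<Sum>k<n. h\<^sup>2 * ?D))"
    using epoch_distance [OF p \<beta>, of _ n h w m]
    by (intro mult_left_mono sum_mono) (auto simp: norm_minus_commute)
  also have "\<dots> = L\<^sup>2 * h\<^sup>2 * ?D" using n by simp
  finally show ?thesis .
qed

lemma epoch_descent: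
  assumes p: "p permutes {1..n}" and \<beta>: "0 \<le> \<beta>" "\<beta> \<le> 1" and h: "0 \<le> h" "L * h \<le> 1"
  shows "F (fst (smg_inner f n \<beta> h p w m n)) \<le> F w - h / 2 * (norm (gradient F w))\<^sup>2
    + h / 2 * (\<beta> * (norm (m - gradient F w))\<^sup>2 + (1 - \<beta>) * epoch_drift f n L \<beta> h p w m)"
proof -
  define v where "v = snd (snd (smg_inner f n \<beta> h p w m n))"
  define d where "d = \<beta> *\<^sub>R m + (1 - \<beta>) *\<^sub>R v"
  have "d - gradient F w = \<beta> *\<^sub>R (m - gradient F w) + (1 - \<beta>) *\<^sub>R (v - gradient F w)"
    by (simp add: d_def algebra_simps)
  then have "(norm (d - gradient F w))\<^sup>2
      \<le> \<beta> * (norm (m - gradient F w))\<^sup>2 + (1 - \<beta>) * (norm (v - gradient F w))\<^sup>2"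
    using norm_convex_combination_squared_le [OF \<beta>] by metis
  also have "\<dots> \<le> \<beta> * (norm (m - gradient F w))\<^sup>2 + (1 - \<beta>) * epoch_drift f n L \<beta> h p w m"
    using epoch_average_error_start [OF p] \<beta> unfolding v_def
    by (intro add_left_mono mult_left_mono) auto
  finally have "h / 2 * (norm (d - gradient F w))\<^sup>2 \<le> h / 2 *
      (\<beta> * (norm (m - gradient F w))\<^sup>2 + (1 - \<beta>) * epoch_drift f n L \<beta> h p w m)"
    using h by (intro mult_left_mono) auto
  moreover have "fst (smg_inner f n \<beta> h p w m n) = w - h *\<^sub>R d"
    unfolding d_def v_def by (rule smg_inner_final [OF n])
  ultimately show ?thesis
    using inexact_gradient_step [OF h, of w d] by simp
qed

end


section \<open>Accumulating the epochs\<close>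

lemma smg_iterate_0: "smg_iterate f n \<beta> \<eta> p w0 0 = w0"
  by (simp add: smg_iterate_def)

lemma smg_iterate_Suc:
  "smg_iterate f n \<beta> \<eta> p w0 (Suc t) = fst (smg_inner f n \<beta> (\<eta> (Suc t)) (p (Suc t))
    (smg_iterate f n \<beta> \<eta> p w0 t) (snd (smg_epochs f n \<beta> \<eta> p w0 t)) n)"
  by (simp add: smg_iterate_def Let_def split_beta)

lemma smg_momentum_Suc:
  "snd (smg_epochs f n \<beta> \<eta> p w0 (Suc t)) = snd (snd (smg_inner f n \<beta> (\<eta> (Suc t)) (p (Suc t))
    (smg_iterate f n \<beta> \<eta> p w0 t) (snd (smg_epochs f n \<beta> \<eta> p w0 t)) n))"
  by (simp add: smg_iterate_def Let_def split_beta)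

lemma smg_iterate_cong:
  assumes "\<And>s. s \<in> {1..t} \<Longrightarrow> p s = q s"
  shows "smg_iterate f n \<beta> \<eta> p w0 t = smg_iterate f n \<beta> \<eta> q w0 t"
proof -
  have "smg_epochs f n \<beta> \<eta> p w0 t = smg_epochs f n \<beta> \<eta> q w0 t"
    using assms by (induction t) auto
  then show ?thesis by (simp add: smg_iterate_def)
qed

text \<open>
  The numerical core. Read \<open>\<Phi> t\<close> as the objective value, \<open>G t\<close> as the squared gradient norm,
  \<open>M t\<close> as the squared norm of the momentum, \<open>e t\<close> as the squared error of the momentum as an
  approximation of the gradient, and \<open>a t\<close> as the drift, all for epoch \<open>t + 1\<close> or at its
  starting point; \<open>b t\<close> is the bound for the drift and for the error of the next momentum. The
  numbers \<open>s\<close> and \<open>S\<close> stand for \<open>L\<^sup>2 h\<^sup>2\<close> and \<open>\<sigma>\<^sup>2\<close>. Since \<open>(1 - \<beta>) / (5 - 3 * \<beta>) \<le> 1 / 5\<close>, the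
  step size condition forces \<open>s \<le> 1 / 45\<close>, so that the terms by which the drift depends on
  itself are absorbed.
\<close>

lemma accumulated_descent:
  fixes \<Phi> G M e a :: "nat \<Rightarrow> real"
  assumes \<beta>: "0 \<le> \<beta>" "\<beta> < 1" and h: "0 \<le> h" and s: "0 \<le> s" and \<Theta>: "0 \<le> \<Theta>" and S: "0 \<le> S"
    and step_size: "9 * (5 - 3 * \<beta>) * (\<Theta> + 1) * s \<le> 1 - \<beta>"
    and G: "\<And>t. 0 \<le> G t" and a: "\<And>t. 0 \<le> a t"
    and b: "\<And>t. b t = s * (\<beta> * M t + 3 * (1 - \<beta>) * (a t + (\<Theta> + 1) * G t + S))"
    and descent: "\<And>t. t < T \<Longrightarrow> \<Phi> (Suc t) \<le> \<Phi> t - h / 2 * G t + h / 2 * (\<beta> * e t + (1 - \<beta>) * a t)"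
    and drift: "\<And>t. t < T \<Longrightarrow> a t \<le> b t"
    and e: "e 0 = G 0" "\<And>t. t < T \<Longrightarrow> e (Suc t) \<le> b t"
    and M: "M 0 = 0" "\<And>t. t < T \<Longrightarrow> M (Suc t) \<le> 2 * (G t + a t)"
    and T: "T \<ge> 1"
    and lower: "\<Phi>_low \<le> \<Phi> T"
  shows "(1 - \<beta>) * h / 4 * (\<Sum>t<T. G t) \<le> \<Phi> 0 - \<Phi>_low + 9 / 4 * (5 - 3 * \<beta>) * S * s * h * real T"
proof -
  define SG SM Sa Sb Se Q where "SG = (\<Sum>t<T. G t)" and "SM = (\<Sum>t<T. M t)"
    and "Sa = (\<Sum>t<T. a t)" and "Sb = (\<Sum>t<T. b t)" and "Se = (\<Sum>t<T. e t)"
    and "Q = (\<Theta> + 1) * SG + real T * S"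
  obtain T' where T': "T = Suc T'" using T by (cases T) auto
  have SG0: "0 \<le> SG" and Sa0: "0 \<le> Sa"
    unfolding SG_def Sa_def by (intro sum_nonneg G a)+
  have SG_le_Q: "SG \<le> Q"
    unfolding Q_def using \<Theta> S SG0 by (simp add: algebra_simps)
  have b_nonneg: "0 \<le> b t" if "t < T" for t
    using a [of t] drift [OF that] by linarith
  have Sa_le: "Sa \<le> Sb"
    unfolding Sa_def Sb_def by (intro sum_mono drift) auto
  \<comment> \<open>In the first epoch the momentum is \<open>0\<close>, so its error is the full squared gradient norm.\<close>
  have Se_le: "Se \<le> SG + Sb"
  proof -
    have "Se = e 0 + (\<Sum>t<T'. e (Suc t))"
      unfolding Se_def T' by (rule sum.lessThan_Suc_shift)
    also have "(\<Sum>t<T'. e (Suc t)) \<le> (\<Sum>t<T'. b t)"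
      by (intro sum_mono e) (simp add: T')
    also have "\<dots> \<le> Sb" unfolding Sb_def T' using b_nonneg by (simp add: T')
    also have "e 0 \<le> SG"
      unfolding SG_def e(1) by (rule member_le_sum) (use G T in auto)
    finally show ?thesis by simp
  qed
  have SM_le: "SM \<le> 2 * (SG + Sa)"
  proof -
    have "SM = (\<Sum>t<T'. M (Suc t))"
      unfolding SM_def T' by (subst sum.lessThan_Suc_shift) (simp add: M)
    also have "\<dots> \<le> (\<Sum>t<T'. 2 * (G t + a t))"
      by (intro sum_mono M) (simp add: T')
    also have "\<dots> \<le> (\<Sum>t<T. 2 * (G t + a t))"
      unfolding T' using G a by simp
    also have "\<dots> = 2 * (SG + Sa)"
      by (simp add: SG_def Sa_def sum.distrib sum_distrib_left)
    finally show ?thesis .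
  qed
  have s_bounds: "s \<le> 1 / 45" "18 * (\<Theta> + 1) * s \<le> 1 - \<beta>"
  proof -
    have "(1 - \<beta>) * 45 * s \<le> 9 * (5 - 3 * \<beta>) * 1 * s"
      using \<beta> s by (intro mult_right_mono) auto
    also have "\<dots> \<le> 9 * (5 - 3 * \<beta>) * (\<Theta> + 1) * s"
      using \<beta> s \<Theta> by (intro mult_right_mono mult_left_mono) auto
    also have "\<dots> \<le> 1 - \<beta>" by (rule step_size)
    finally have "(1 - \<beta>) * (45 * s) \<le> (1 - \<beta>) * 1"
      by (simp only: mult.assoc mult_1_right)
    then have "45 * s \<le> 1"
      by (rule mult_left_le_imp_le) (use \<beta> in simp)
    then show "s \<le> 1 / 45" by simp
    have "2 * (9 * ((\<Theta> + 1) * s)) \<le> (5 - 3 * \<beta>) * (9 * ((\<Theta> + 1) * s))"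
      using \<beta> s \<Theta> by (intro mult_right_mono) auto
    also have "\<dots> = 9 * (5 - 3 * \<beta>) * (\<Theta> + 1) * s" by (simp only: mult_ac)
    also have "\<dots> \<le> 1 - \<beta>" by (rule step_size)
    finally show "18 * (\<Theta> + 1) * s \<le> 1 - \<beta>" by (simp add: algebra_simps)
  qed
  have Sb_le: "Sb \<le> 4 * s * Q"
  proof -
    have "Sb = s * (\<beta> * SM + 3 * (1 - \<beta>) * (Sa + Q))"
      by (simp add: Sb_def b SM_def Sa_def Q_def SG_def sum.distrib sum_distrib_left distrib_left mult.assoc)
    also have "\<dots> \<le> s * (\<beta> * (3 * (Sa + Q)) + 3 * (1 - \<beta>) * (Sa + Q))"
      using SM_le SG_le_Q Sa0 SG0 \<beta> s
      by (intro mult_left_mono add_right_mono) auto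
    also have "\<dots> = s * (3 * (Sa + Q))"
      by (simp add: algebra_simps)
    also have "\<dots> \<le> s * (3 * Sb) + s * (3 * Q)"
      using mult_left_mono [OF Sa_le s] by (simp add: algebra_simps)
    also have "s * (3 * Sb) \<le> 1 / 45 * (3 * Sb)"
      using s_bounds(1) Sa0 Sa_le by (intro mult_right_mono) auto
    finally have "14 * Sb \<le> 45 * (s * Q)" by simp
    moreover have "0 \<le> s * Q" using s SG0 SG_le_Q by simp
    ultimately show ?thesis by simp
  qed
  have telescope: "\<Phi> T \<le> \<Phi> 0 - h / 2 * SG + h / 2 * (\<beta> * Se + (1 - \<beta>) * Sa)"
  proof -
    have "(\<Sum>t<T. \<Phi> (Suc t) - \<Phi> t)
        \<le> (\<Sum>t<T. - (h / 2 * G t) + h / 2 * (\<beta> * e t + (1 - \<beta>) * a t))"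
    proof (rule sum_mono)
      fix t assume "t \<in> {..<T}"
      then show "\<Phi> (Suc t) - \<Phi> t \<le> - (h / 2 * G t) + h / 2 * (\<beta> * e t + (1 - \<beta>) * a t)"
        using descent [of t] by simp
    qed
    also have "(\<Sum>t<T. \<Phi> (Suc t) - \<Phi> t) = \<Phi> T - \<Phi> 0"
      by (rule sum_lessThan_telescope)
    finally show ?thesis
      unfolding SG_def Se_def Sa_def sum.distrib sum_negf sum_distrib_left [symmetric]
      by (simp add: algebra_simps)
  qed
  have "\<beta> * Se + (1 - \<beta>) * Sa \<le> \<beta> * (SG + Sb) + (1 - \<beta>) * Sb"
    using Se_le Sa_le \<beta> by (intro add_mono mult_left_mono) auto
  also have "\<dots> = \<beta> * SG + Sb" by (simp add: algebra_simps)
  also have "\<dots> \<le> \<beta> * SG + (1 - \<beta>) / 2 * SG + 4 * s * S * real T"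
  proof -
    define X Y where "X = (\<Theta> + 1) * s * SG" and "Y = (1 - \<beta>) * SG"
    have "18 * (\<Theta> + 1) * s * SG \<le> (1 - \<beta>) * SG"
      by (intro mult_right_mono s_bounds SG0)
    then have "18 * X \<le> Y" by (simp only: X_def Y_def mult.assoc)
    moreover have "0 \<le> Y" using \<beta> SG0 by (simp add: Y_def)
    ultimately have "4 * X \<le> Y / 2" by linarith
    moreover have "4 * s * Q = 4 * X + 4 * s * S * real T"
      by (simp add: Q_def X_def algebra_simps)
    moreover have "(1 - \<beta>) / 2 * SG = Y / 2" by (simp add: Y_def)
    ultimately show ?thesis using Sb_le by linarith
  qed
  finally have "h / 2 * (\<beta> * Se + (1 - \<beta>) * Sa)
      \<le> h / 2 * (\<beta> * SG + (1 - \<beta>) / 2 * SG + 4 * s * S * real T)"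
    using h by (intro mult_left_mono) auto
  moreover have "h / 2 * SG - h / 2 * (\<beta> * SG + (1 - \<beta>) / 2 * SG + 4 * s * S * real T)
      = (1 - \<beta>) * h / 4 * SG - 2 * (S * s * h * real T)"
    by (simp add: field_simps)
  ultimately have "(1 - \<beta>) * h / 4 * SG \<le> \<Phi> 0 - \<Phi>_low + 2 * (S * s * h * real T)"
    using telescope lower by linarith
  moreover have "2 * (S * s * h * real T) \<le> 9 / 4 * (5 - 3 * \<beta>) * (S * s * h * real T)"
    using \<beta> S s h by (intro mult_right_mono) auto
  ultimately show ?thesis
    unfolding SG_def by (simp add: mult.assoc)
qed

text \<open>
  The deterministic statement behind the convergence rate: it holds for every fixed sequence of
  permutations.
\<close>

lemma (in smooth_average) sum_gradients_le:
  assumes p: "\<And>t. t \<in> {1..T} \<Longrightarrow> p t permutes {1..n}" and T: "T \<ge> 1"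
    and \<beta>: "0 \<le> \<beta>" "\<beta> < 1" and h: "0 \<le> h"
    and step_size: "9 * (5 - 3 * \<beta>) * (\<Theta> + 1) * (L\<^sup>2 * h\<^sup>2) \<le> 1 - \<beta>"
    and lower: "\<And>w. F_low \<le> F w"
  shows "(1 - \<beta>) * h / 4 * (\<Sum>t<T. (norm (gradient F (smg_iterate f n \<beta> (\<lambda>_. h) p w0 t)))\<^sup>2)
    \<le> F w0 - F_low + 9 / 4 * (5 - 3 * \<beta>) * \<sigma>\<^sup>2 * (L\<^sup>2 * h\<^sup>2) * h * real T"
proof -
  define W where "W t = smg_iterate f n \<beta> (\<lambda>_. h) p w0 t" for t
  define m where "m t = snd (smg_epochs f n \<beta> (\<lambda>_. h) p w0 t)" for t
  define a where "a t = epoch_drift f n L \<beta> h (p (Suc t)) (W t) (m t)" for t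
  have W_Suc: "W (Suc t) = fst (smg_inner f n \<beta> h (p (Suc t)) (W t) (m t) n)" for t
    unfolding W_def m_def by (rule smg_iterate_Suc)
  have m_Suc: "m (Suc t) = snd (snd (smg_inner f n \<beta> h (p (Suc t)) (W t) (m t) n))" for t
    unfolding W_def m_def by (rule smg_momentum_Suc)
  have p': "p (Suc t) permutes {1..n}" if "t < T" for t
    using p that by simp
  have "(L * h)\<^sup>2 \<le> 1"
  proof -
    have "2 * (L\<^sup>2 * h\<^sup>2) \<le> 9 * (5 - 3 * \<beta>) * (\<Theta> + 1) * (L\<^sup>2 * h\<^sup>2)"
    proof (rule mult_right_mono)
      have "2 * 1 \<le> (9 * (5 - 3 * \<beta>)) * (\<Theta> + 1)"
        using \<beta> Theta by (intro mult_mono) auto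
      then show "2 \<le> 9 * (5 - 3 * \<beta>) * (\<Theta> + 1)" by simp
    qed simp
    then show ?thesis using step_size \<beta> by (simp add: power_mult_distrib)
  qed
  then have Lh: "L * h \<le> 1"
    by (simp add: abs_square_le_1)
  have "(1 - \<beta>) * h / 4 * (\<Sum>t<T. (norm (gradient F (W t)))\<^sup>2)
      \<le> F (W 0) - F_low + 9 / 4 * (5 - 3 * \<beta>) * \<sigma>\<^sup>2 * (L\<^sup>2 * h\<^sup>2) * h * real T"
  proof (rule accumulated_descent
      [where M = "\<lambda>t. (norm (m t))\<^sup>2" and e = "\<lambda>t. (norm (m t - gradient F (W t)))\<^sup>2"
        and \<Phi> = "\<lambda>t. F (W t)" and a = a and b = "\<lambda>t. L\<^sup>2 * h\<^sup>2 * (\<beta> * (norm (m t))\<^sup>2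
          + 3 * (1 - \<beta>) * (a t + (\<Theta> + 1) * (norm (gradient F (W t)))\<^sup>2 + \<sigma>\<^sup>2))" and \<Theta> = \<Theta>])
    fix t
    show "0 \<le> a t" unfolding a_def epoch_drift_def by (simp add: sum_nonneg)
    assume t: "t < T"
    show "F (W (Suc t)) \<le> F (W t) - h / 2 * (norm (gradient F (W t)))\<^sup>2
        + h / 2 * (\<beta> * (norm (m t - gradient F (W t)))\<^sup>2 + (1 - \<beta>) * a t)"
      unfolding W_Suc a_def using epoch_descent [OF p' [OF t]] \<beta> h Lh by simp
    show "a t \<le> L\<^sup>2 * h\<^sup>2 * (\<beta> * (norm (m t))\<^sup>2
        + 3 * (1 - \<beta>) * (a t + (\<Theta> + 1) * (norm (gradient F (W t)))\<^sup>2 + \<sigma>\<^sup>2))"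
      unfolding a_def by (rule epoch_drift_le [OF p' [OF t]]) (use \<beta> in auto)
    show "(norm (m (Suc t) - gradient F (W (Suc t))))\<^sup>2 \<le> L\<^sup>2 * h\<^sup>2 * (\<beta> * (norm (m t))\<^sup>2
        + 3 * (1 - \<beta>) * (a t + (\<Theta> + 1) * (norm (gradient F (W t)))\<^sup>2 + \<sigma>\<^sup>2))"
      unfolding W_Suc m_Suc a_def by (rule epoch_average_error_end [OF p' [OF t]]) (use \<beta> in auto)
    have "(norm (m (Suc t) - gradient F (W t)))\<^sup>2 \<le> a t"
      unfolding m_Suc a_def by (rule epoch_average_error_start [OF p' [OF t]])
    then show "(norm (m (Suc t)))\<^sup>2 \<le> 2 * ((norm (gradient F (W t)))\<^sup>2 + a t)"
      by (intro order_trans [OF norm_squared_le_twice [of "m (Suc t)" "gradient F (W t)"]]) simp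
  qed (use \<beta> h Theta step_size T lower in \<open>auto simp: m_def\<close>)
  then show ?thesis
    by (simp add: W_def smg_iterate_0)
qed

lemma (in smooth_average) average_gradients_le:
  assumes p: "\<And>t. t \<in> {1..T} \<Longrightarrow> p t permutes {1..n}" and T: "T \<ge> 1"
    and \<beta>: "0 \<le> \<beta>" "\<beta> < 1" and h: "0 < h"
    and step_size: "9 * (5 - 3 * \<beta>) * (\<Theta> + 1) * (L\<^sup>2 * h\<^sup>2) \<le> 1 - \<beta>"
    and lower: "\<And>w. F_low \<le> F w"
  shows "1 / real T * (\<Sum>t<T. (norm (gradient F (smg_iterate f n \<beta> (\<lambda>_. h) p w0 t)))\<^sup>2)
    \<le> 4 * (F w0 - F_low) / ((1 - \<beta>) * h * real T) + 9 * \<sigma>\<^sup>2 * (5 - 3 * \<beta>) * L\<^sup>2 * h\<^sup>2 / (1 - \<beta>)"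
    (is "_ * ?S \<le> _")
proof -
  let ?c = "4 / ((1 - \<beta>) * h * real T)"
  have "1 / real T * ?S = ?c * ((1 - \<beta>) * h / 4 * ?S)"
    using \<beta> h by simp
  also have "\<dots> \<le> ?c * (F w0 - F_low + 9 / 4 * (5 - 3 * \<beta>) * \<sigma>\<^sup>2 * (L\<^sup>2 * h\<^sup>2) * h * real T)"
    using \<beta> h T by (intro mult_left_mono sum_gradients_le p step_size lower) auto
  also have "\<dots> = 4 * (F w0 - F_low) / ((1 - \<beta>) * h * real T)
      + 9 * \<sigma>\<^sup>2 * (5 - 3 * \<beta>) * L\<^sup>2 * h\<^sup>2 / (1 - \<beta>)"
  proof -
    have eq: "4 / (d * h * real T) * (X + 9 / 4 * c * \<sigma>\<^sup>2 * (L\<^sup>2 * h\<^sup>2) * h * real T)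
        = 4 * X / (d * h * real T) + 9 * \<sigma>\<^sup>2 * c * L\<^sup>2 * h\<^sup>2 / d" if "0 < d" for c d X
      using that h T by (simp add: field_simps)
    show ?thesis by (rule eq) (use \<beta> in simp)
  qed
  finally show ?thesis .
qed


section \<open>The random output\<close>

context smg_randomness
begin

text \<open>
  Only finitely many pairs of an output index and a family of permutations occur, so expectations
  are finite sums. Independence of the index turns a bound that holds for each fixed family of
  permutations after averaging over the index into a bound for the expectation.
\<close>

lemma expectation_output_le:
  fixes H :: "nat \<Rightarrow> (nat \<Rightarrow> nat \<Rightarrow> nat) \<Rightarrow> real"
  assumes bound: "\<And>q. q \<in> {1..T} \<rightarrow>\<^sub>E {q. q permutes {1..n}} \<Longrightarrow>
      (\<Sum>t=1..T. \<eta> t / (\<Sum>s=1..T. \<eta> s) * H t q) \<le> C"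
  shows "expectation (\<lambda>\<omega>. H (\<tau> \<omega>) (\<lambda>t\<in>{1..T}. p t \<omega>)) \<le> C"
proof -
  define S where "S = {1..T} \<rightarrow>\<^sub>E {q. q permutes {1..n::nat}}"
  define P where "P \<omega> = (\<lambda>t\<in>{1..T}. p t \<omega>)" for \<omega>
  define A where "A t = \<tau> -` {t} \<inter> space M" for t
  define B where "B q = P -` {q} \<inter> space M" for q
  have finite_perms: "finite {q. q permutes {1..n}}"
    by (simp add: finite_permutations)
  have finite_S: "finite S"
    unfolding S_def by (intro finite_PiE finite_perms) auto
  have PiM_eq: "Pi\<^sub>M {1..T} (\<lambda>_. count_space {q. q permutes {1..n}}) = count_space S"
    unfolding S_def by (rule count_space_PiM_finite) (simp, rule countable_finite [OF finite_perms])
  have P_meas: "P \<in> M \<rightarrow>\<^sub>M count_space S"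
    unfolding P_def PiM_eq [symmetric] by (intro measurable_restrict perm)
  have P_in: "P \<omega> \<in> S" if "\<omega> \<in> space M" for \<omega>
    using measurable_space [OF P_meas that] by simp
  have \<tau>_in: "\<tau> \<omega> \<in> {1..T}" if "\<omega> \<in> space M" for \<omega>
    using measurable_space [OF index that] by simp
  have A_event: "A t \<in> events" if "t \<in> {1..T}" for t
    unfolding A_def using that by (intro measurable_sets [OF index]) auto
  have B_event: "B q \<in> events" if "q \<in> S" for q
    unfolding B_def using that by (intro measurable_sets [OF P_meas]) auto
  have prob_A: "prob (A t) = \<eta> t / (\<Sum>s=1..T. \<eta> s)" if "t \<in> {1..T}" for t
    using index_prob [OF that] by (simp add: A_def vimage_def Int_def conj_commute)
  have prob_AB: "prob (A t \<inter> B q) = prob (A t) * prob (B q)" if "t \<in> {1..T}" "q \<in> S" for t q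
  proof (rule indep_setD [OF index_indep])
    show "A t \<in> {\<tau> -` A \<inter> space M | A. A \<in> sets (count_space {1..T})}"
      unfolding A_def using that by (intro CollectI exI [of _ "{t}"]) auto
    show "B q \<in> {(\<lambda>\<omega>. \<lambda>t\<in>{1..T}. p t \<omega>) -` A \<inter> space M | A.
        A \<in> sets (Pi\<^sub>M {1..T} (\<lambda>_. count_space {q. q permutes {1..n}}))}"
      unfolding B_def P_def PiM_eq using that by (intro CollectI exI [of _ "{q}"]) auto
  qed
  have sum_prob_B: "(\<Sum>q\<in>S. prob (B q)) = 1"
  proof -
    have "(\<Sum>q\<in>S. prob (B q)) = expectation (\<lambda>\<omega>. \<Sum>q\<in>S. indicator (B q) \<omega>)"
      using B_event by (subst Bochner_Integration.integral_sum)
        (auto intro!: integrable_real_indicator simp: emeasure_eq_measure)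
    also have "\<dots> = expectation (\<lambda>_. 1)"
    proof (rule Bochner_Integration.integral_cong)
      fix \<omega> assume \<omega>: "\<omega> \<in> space M"
      have "(\<Sum>q\<in>S. indicator (B q) \<omega>) = (\<Sum>q\<in>S. if q = P \<omega> then 1 else 0 :: real)"
        using \<omega> by (intro sum.cong) (auto simp: B_def)
      then show "(\<Sum>q\<in>S. indicator (B q) \<omega>) = (1 :: real)"
        using P_in [OF \<omega>] finite_S by simp
    qed simp
    finally show ?thesis by (simp add: prob_space)
  qed
  have "expectation (\<lambda>\<omega>. H (\<tau> \<omega>) (P \<omega>))
      = expectation (\<lambda>\<omega>. \<Sum>q\<in>S. \<Sum>t=1..T. H t q * indicator (A t \<inter> B q) \<omega>)"
  proof (rule Bochner_Integration.integral_cong)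
    fix \<omega> assume \<omega>: "\<omega> \<in> space M"
    have "(\<Sum>q\<in>S. \<Sum>t=1..T. H t q * indicator (A t \<inter> B q) \<omega>)
        = (\<Sum>q\<in>S. \<Sum>t=1..T. if t = \<tau> \<omega> then (if q = P \<omega> then H t q else 0) else 0)"
      using \<omega> by (intro sum.cong) (auto simp: A_def B_def)
    also have "\<dots> = H (\<tau> \<omega>) (P \<omega>)"
      using P_in [OF \<omega>] \<tau>_in [OF \<omega>] finite_S by simp
    finally show "H (\<tau> \<omega>) (P \<omega>) = (\<Sum>q\<in>S. \<Sum>t=1..T. H t q * indicator (A t \<inter> B q) \<omega>)"
      by simp
  qed simp
  also have "\<dots> = (\<Sum>q\<in>S. \<Sum>t=1..T. H t q * prob (A t \<inter> B q))"
  proof -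
    have int: "integrable M (\<lambda>\<omega>. H t q * indicator (A t \<inter> B q) \<omega>)"
      if "t \<in> {1..T}" "q \<in> S" for t q
      using A_event [OF that(1)] B_event [OF that(2)]
      by (intro integrable_real_mult_indicator) auto
    have "expectation (\<lambda>\<omega>. \<Sum>q\<in>S. \<Sum>t=1..T. H t q * indicator (A t \<inter> B q) \<omega>)
        = (\<Sum>q\<in>S. expectation (\<lambda>\<omega>. \<Sum>t=1..T. H t q * indicator (A t \<inter> B q) \<omega>))"
      by (intro Bochner_Integration.integral_sum Bochner_Integration.integrable_sum int)
    also have "\<dots> = (\<Sum>q\<in>S. \<Sum>t=1..T. expectation (\<lambda>\<omega>. H t q * indicator (A t \<inter> B q) \<omega>))"
      by (intro sum.cong refl Bochner_Integration.integral_sum int)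
    also have "\<dots> = (\<Sum>q\<in>S. \<Sum>t=1..T. H t q * prob (A t \<inter> B q))"
      using A_event B_event by (intro sum.cong refl) simp
    finally show ?thesis .
  qed
  also have "\<dots> = (\<Sum>q\<in>S. prob (B q) * (\<Sum>t=1..T. \<eta> t / (\<Sum>s=1..T. \<eta> s) * H t q))"
    by (simp add: prob_AB prob_A sum_distrib_left mult_ac)
  also have "\<dots> \<le> (\<Sum>q\<in>S. prob (B q) * C)"
    by (intro sum_mono mult_left_mono bound) (auto simp: S_def)
  also have "\<dots> = C"
    by (simp add: sum_prob_B sum_distrib_right [symmetric])
  finally show ?thesis unfolding P_def .
qed

end


section \<open>The convergence rate\<close>

text \<open>
  For a constant learning rate the output index is uniform on \<open>{1..T}\<close>. The index \<open>t\<close> stands for the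
  iterate after \<open>t - 1\<close> epochs, which involves only the permutations of these epochs.
\<close>

lemma (in smooth_average) expectation_output_gradient_le:
  assumes rnd: "smg_randomness M n T (\<lambda>_. h) p \<tau>" and T: "T \<ge> 1"
    and \<beta>: "0 \<le> \<beta>" "\<beta> < 1" and h: "0 < h"
    and step_size: "9 * (5 - 3 * \<beta>) * (\<Theta> + 1) * (L\<^sup>2 * h\<^sup>2) \<le> 1 - \<beta>"
    and lower: "\<And>w. F_low \<le> F w"
  shows "(\<integral>\<omega>. (norm (gradient F (smg_output f n \<beta> (\<lambda>_. h) p \<tau> w0 \<omega>)))\<^sup>2 \<partial>M)
    \<le> 4 * (F w0 - F_low) / ((1 - \<beta>) * h * real T) + 9 * \<sigma>\<^sup>2 * (5 - 3 * \<beta>) * L\<^sup>2 * h\<^sup>2 / (1 - \<beta>)"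
    (is "_ \<le> ?C")
proof -
  interpret smg_randomness M n T "\<lambda>_. h" p \<tau> by (rule rnd)
  let ?H = "\<lambda>t q. (norm (gradient F (smg_iterate f n \<beta> (\<lambda>_. h) q w0 (t - 1))))\<^sup>2"
  have "(\<integral>\<omega>. (norm (gradient F (smg_output f n \<beta> (\<lambda>_. h) p \<tau> w0 \<omega>)))\<^sup>2 \<partial>M)
      = (\<integral>\<omega>. ?H (\<tau> \<omega>) (\<lambda>t\<in>{1..T}. p t \<omega>) \<partial>M)"
  proof (rule Bochner_Integration.integral_cong)
    fix \<omega> assume "\<omega> \<in> space M"
    then have "\<tau> \<omega> \<in> {1..T}" using measurable_space [OF index] by simp
    then have "smg_iterate f n \<beta> (\<lambda>_. h) (\<lambda>t. p t \<omega>) w0 (\<tau> \<omega> - 1)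
        = smg_iterate f n \<beta> (\<lambda>_. h) (\<lambda>t\<in>{1..T}. p t \<omega>) w0 (\<tau> \<omega> - 1)"
      by (intro smg_iterate_cong) auto
    then show "(norm (gradient F (smg_output f n \<beta> (\<lambda>_. h) p \<tau> w0 \<omega>)))\<^sup>2
        = ?H (\<tau> \<omega>) (\<lambda>t\<in>{1..T}. p t \<omega>)"
      by (simp add: smg_output_def)
  qed simp
  also have "\<dots> \<le> ?C"
  proof (rule expectation_output_le)
    fix q assume q: "q \<in> {1..T} \<rightarrow>\<^sub>E {q. q permutes {1..n}}"
    have "(\<Sum>t=1..T. h / (\<Sum>s=1..T. h) * ?H t q) = 1 / real T * (\<Sum>t=1..T. ?H t q)"
      using h T by (simp add: sum_distrib_left)
    also have "(\<Sum>t=1..T. ?H t q) = (\<Sum>t<T. ?H (Suc t) q)"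
      by (rule sum.reindex_bij_witness [of _ Suc "\<lambda>t. t - 1"]) auto
    also have "1 / real T * \<dots> \<le> ?C"
      using average_gradients_le [of T q \<beta> h F_low w0] q T \<beta> h step_size lower
      by (auto simp: PiE_iff)
    finally show "(\<Sum>t=1..T. h / (\<Sum>s=1..T. h) * ?H t q) \<le> ?C" .
  qed
  finally show ?thesis .
qed

theorem corollary1:
  fixes f :: "nat \<Rightarrow> 'a::euclidean_space \<Rightarrow> real"
    and F :: "'a \<Rightarrow> real"
    and w0 :: 'a
    and n :: nat
    and L \<Theta> \<sigma> \<beta> K \<gamma> F_star :: real
  assumes n: "n \<ge> 1"
    and F: "F = avg_objective f n"
    and differentiable: "\<And>i w. i \<in> {1..n} \<Longrightarrow> f i differentiable (at w)"
    and bounded_below: "bdd_below (range F)"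
    and F_star: "F_star = (INF w. F w)"
    and L: "L > 0"
    and smooth: "\<And>i w w'. i \<in> {1..n} \<Longrightarrow>
      norm (gradient (f i) w - gradient (f i) w') \<le> L * norm (w - w')"
    and Theta: "\<Theta> \<ge> 0" and sigma: "\<sigma> \<ge> 0"
    and variance: "\<And>w. (1 / real n) * (\<Sum>i=1..n. (norm (gradient (f i) w - gradient F w))\<^sup>2)
      \<le> \<Theta> * (norm (gradient F w))\<^sup>2 + \<sigma>\<^sup>2"
    and beta: "0 \<le> \<beta>" "\<beta> < 1"
    and K: "K = max (5 / 2) (9 * (5 - 3 * \<beta>) * (\<Theta> + 1) / (1 - \<beta>))"
    and gamma: "\<gamma> > 0"
  shows
    "(\<forall>(T::nat) (M::'w measure) p \<tau>.
        T \<ge> 1 \<longrightarrow> \<gamma> / real T powr (1/3) \<le> 1 / (L * sqrt K) \<longrightarrow>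
        smg_randomness M n T (\<lambda>_. \<gamma> / real T powr (1/3)) p \<tau> \<longrightarrow>
        (\<integral>\<omega>. (norm (gradient F (smg_output f n \<beta> (\<lambda>_. \<gamma> / real T powr (1/3)) p \<tau> w0 \<omega>)))\<^sup>2 \<partial>M)
          \<le> 1 / real T powr (2/3) *
            (4 * (F w0 - F_star) / ((1 - \<beta>) * \<gamma>)
              + 9 * \<sigma>\<^sup>2 * (5 - 3 * \<beta>) * L\<^sup>2 * \<gamma>\<^sup>2 / (1 - \<beta>))) \<and>
     (\<forall>(M::nat \<Rightarrow> 'w measure) p \<tau>.
        (\<forall>T\<ge>1. \<gamma> / real T powr (1/3) \<le> 1 / (L * sqrt K) \<longrightarrow>
          smg_randomness (M T) n T (\<lambda>_. \<gamma> / real T powr (1/3)) (p T) (\<tau> T)) \<longrightarrow>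
        (\<lambda>T. \<integral>\<omega>. (norm (gradient F
              (smg_output f n \<beta> (\<lambda>_. \<gamma> / real T powr (1/3)) (p T) (\<tau> T) w0 \<omega>)))\<^sup>2 \<partial>M T)
          \<in> O(\<lambda>T. real T powr (-2/3)))"
proof -
  interpret smooth_average f n L \<Theta> \<sigma>
    by standard (use n differentiable L smooth Theta variance F in auto)
  let ?h = "\<lambda>T. \<gamma> / real T powr (1/3)"
  let ?C = "4 * (F w0 - F_star) / ((1 - \<beta>) * \<gamma>)
    + 9 * \<sigma>\<^sup>2 * (5 - 3 * \<beta>) * L\<^sup>2 * \<gamma>\<^sup>2 / (1 - \<beta>)"
  let ?I = "\<lambda>T M p \<tau>. \<integral>\<omega>. (norm (gradient F (smg_output f n \<beta> (\<lambda>_. ?h T) p \<tau> w0 \<omega>)))\<^sup>2 \<partial>M"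
  have lower: "F_star \<le> F w" for w
    unfolding F_star by (rule cINF_lower [OF bounded_below]) simp
  have K_pos: "K > 0"
    unfolding K by simp
  have bound: "?I T M p \<tau> \<le> 1 / real T powr (2/3) * ?C"
    if T: "T \<ge> 1" and small: "?h T \<le> 1 / (L * sqrt K)"
      and rnd: "smg_randomness M n T (\<lambda>_. ?h T) p \<tau>"
    for T :: nat and M :: "'w measure" and p \<tau>
  proof -
    have h: "?h T > 0" using gamma T by simp
    have square: "(x * (L * sqrt K))\<^sup>2 = K * (L\<^sup>2 * x\<^sup>2)" for x
      using K_pos by (simp add: power_mult_distrib)
    have "?h T * (L * sqrt K) \<le> 1"
      using small L K_pos by (simp add: pos_le_divide_eq)
    then have "(?h T * (L * sqrt K))\<^sup>2 \<le> 1"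
      using h L K_pos by (intro power_le_one mult_nonneg_nonneg) auto
    then have "K * (L\<^sup>2 * (?h T)\<^sup>2) \<le> 1"
      using K_pos by (simp only: square)
    moreover have "9 * (5 - 3 * \<beta>) * (\<Theta> + 1) / (1 - \<beta>) * (L\<^sup>2 * (?h T)\<^sup>2) \<le> K * (L\<^sup>2 * (?h T)\<^sup>2)"
      unfolding K by (intro mult_right_mono) auto
    ultimately have "9 * (5 - 3 * \<beta>) * (\<Theta> + 1) / (1 - \<beta>) * (L\<^sup>2 * (?h T)\<^sup>2) \<le> 1"
      by (rule order_trans [rotated])
    then have step_size: "9 * (5 - 3 * \<beta>) * (\<Theta> + 1) * (L\<^sup>2 * (?h T)\<^sup>2) \<le> 1 - \<beta>"
      using beta by (simp add: pos_divide_le_eq)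
    have "?I T M p \<tau> \<le> 4 * (F w0 - F_star) / ((1 - \<beta>) * ?h T * real T)
        + 9 * \<sigma>\<^sup>2 * (5 - 3 * \<beta>) * L\<^sup>2 * (?h T)\<^sup>2 / (1 - \<beta>)"
      unfolding F
      by (rule expectation_output_gradient_le [OF rnd T beta h step_size])
         (use lower in \<open>simp add: F\<close>)
    also have "(?h T)\<^sup>2 = \<gamma>\<^sup>2 / real T powr (2/3)"
      by (simp add: power_divide power2_eq_square powr_add [symmetric])
    also have "(1 - \<beta>) * ?h T * real T = (1 - \<beta>) * \<gamma> * real T powr (2/3)"
    proof -
      have "real T = real T powr (1/3) * real T powr (2/3)"
        using T by (simp add: powr_add [symmetric])
      then show ?thesis using T by (simp add: field_simps)
    qed
    finally show ?thesis by (simp add: distrib_left mult_ac)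
  qed
  have rate: "(\<lambda>T. ?I T (M T) (p T) (\<tau> T)) \<in> O(\<lambda>T. real T powr (-2/3))"
    if rnd: "\<forall>T\<ge>1. ?h T \<le> 1 / (L * sqrt K) \<longrightarrow>
      smg_randomness (M T) n T (\<lambda>_. ?h T) (p T) (\<tau> T)"
    for M :: "nat \<Rightarrow> 'w measure" and p \<tau>
  proof (rule bigoI)
    have "?h \<longlonglongrightarrow> 0" by real_asymp
    moreover have "0 < 1 / (L * sqrt K)" using L K_pos by simp
    ultimately have "eventually (\<lambda>T. ?h T < 1 / (L * sqrt K)) sequentially"
      by (rule order_tendstoD)
    then show "eventually (\<lambda>T. norm (?I T (M T) (p T) (\<tau> T)) \<le> ?C * norm (real T powr (-2/3))) sequentially"
      using eventually_ge_at_top [of 1]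
    proof eventually_elim
      case (elim T)
      then have "?I T (M T) (p T) (\<tau> T) \<le> 1 / real T powr (2/3) * ?C"
        using rnd by (intro bound) auto
      also have "\<dots> = ?C * norm (real T powr (-2/3))"
        by (simp add: powr_minus_divide)
      finally show ?case by simp
    qed
  qed
  show ?thesis
    using bound rate by blast
qed

end
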